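(* There is a universal constant $C > 0$ such that for every positive integer $n$ and every integral lattice $\mathcal{L} \subset \mathbb{R}^n$, \[ \sum_{\boldsymbol{y} \in \mathcal{L}} \exp(-\tau^* \|\boldsymbol{y}\|^2) \leq 1 + C/n , \] where $\tau^* := 2\log(2n)$.
   Context: A lattice $\mathcal{L} \subset \mathbb{R}^n$ is the set of integer linear combinations of some linearly independent vectors in $\mathbb{R}^n$. It is called integral if $\langle \boldsymbol{y}_1, \boldsymbol{y}_2\rangle \in \mathbb{Z}$ for all $\boldsymbol{y}_1, \boldsymbol{y}_2 \in \mathcal{L}$, where $\langle\cdot,\cdot\rangle$ is the standard inner product. $\|\cdot\|$ is the Euclidean norm and $\log$ is the natural logarithm. *)

theory Defs
  imports "HOL-Analysis.Infinite_Sum" "Jordan_Normal_Form.VS_Connect"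
begin

text \<open>
  The constant in the theorem is uniform in the dimension \<open>n\<close>, so \<open>n\<close> must be a term: real
  \<open>n\<close>-space is \<^term>\<open>carrier_vec n :: real Matrix.vec set\<close> rather than a type \<open>real ^ 'n\<close>.
  Names that also exist in HOL-Analysis are qualified, and \<^const>\<open>scalar_prod\<close> is written in
  prefix form, because \<open>\<bullet>\<close> also denotes the inner product there.
\<close>

text \<open>
  The rank may be smaller than \<open>n\<close>; the empty basis gives the zero lattice. Distinctness is
  required because linear independence is a property of the set of basis vectors, whereas
  \<open>lattice_of\<close>, the set of integer linear combinations, takes a list.
\<close>

definition is_lattice :: "nat \<Rightarrow> real Matrix.vec set \<Rightarrow> bool" where
  "is_lattice n L \<longleftrightarrow>
    (\<exists>bs. set bs \<subseteq> carrier_vec n \<and> distinct bs \<and>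
      LinearCombinations.module.lin_indpt class_ring (module_vec TYPE(real) n) (set bs) \<and>
      L = vec_module.lattice_of n bs)"

definition is_integral_lattice :: "nat \<Rightarrow> real Matrix.vec set \<Rightarrow> bool" where
  "is_integral_lattice n L \<longleftrightarrow>
    is_lattice n L \<and> (\<forall>y1 \<in> L. \<forall>y2 \<in> L. scalar_prod y1 y2 \<in> \<int>)"

definition euclid_norm :: "real Matrix.vec \<Rightarrow> real" where
  "euclid_norm v = sqrt (scalar_prod v v)"

definition tau_star :: "nat \<Rightarrow> real" where
  "tau_star n = 2 * ln (2 * real n)"

end

theory Submission
  imports Defs "HOL-Library.Function_Algebras"
begin

text \<open>
  The norms \<open>\<parallel>y\<parallel>\<^sup>2\<close> of an integral lattice are nonnegative integers, so the sum splits into shells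
  \<open>\<parallel>y\<parallel>\<^sup>2 = k\<close>, on which the summand is \<open>(2n)\<^bsup>-2k\<^esup>\<close>. Everything rests on a bound for the
  number of points in a shell with \<open>k \<ge> 1\<close> (lemma \<open>card_shell_le\<close>): it is at most \<open>2 n\<^bsup>2k-1\<^esup>\<close>.
  Since the shell \<open>k = 0\<close> is the origin alone, the sum is then at most
  \<open>1 + (2/n) (1/4 + 1/16 + \<dots>) = 1 + 2/(3n) \<le> 1 + 1/n\<close>.

  The bound on a shell is the polynomial method for few-distance sets, applied to one point from each
  pair \<open>{x, -x}\<close>. Two distinct such points have an integer inner product strictly between \<open>-k\<close>
  and \<open>k\<close>, so on the shell the polynomial
  \<open>f\<^sub>x(v) = \<langle>v,x\<rangle> \<Prod>\<^bsub>0<j<k\<^esub> (\<langle>v,x\<rangle>\<^sup>2 - (j\<^sup>2/k) \<parallel>v\<parallel>\<^sup>2)\<close>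
  vanishes at all the chosen points except \<open>x\<close>. Hence the \<open>f\<^sub>x\<close> are linearly independent. The factor
  \<open>\<parallel>v\<parallel>\<^sup>2/k\<close>, which equals 1 on the shell, makes \<open>f\<^sub>x\<close> homogeneous of degree \<open>2k-1\<close>, so all
  \<open>f\<^sub>x\<close> lie in the span of the \<open>n\<^bsup>2k-1\<^esup>\<close> words of length \<open>2k-1\<close> in the coordinates. Passing to
  half of the shell is what lowers the degree from \<open>2k\<close> to \<open>2k-1\<close>; the factor \<open>1/n\<close> gained in this way is
  the one in the theorem.
\<close>

section \<open>Linear independence of functions\<close>

definition scale_fun :: "real \<Rightarrow> ('a \<Rightarrow> real) \<Rightarrow> 'a \<Rightarrow> real" where
  "scale_fun c f = (\<lambda>x. c * f x)"

interpretation fun_space: vector_space "scale_fun :: real \<Rightarrow> ('a \<Rightarrow> real) \<Rightarrow> 'a \<Rightarrow> real"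
  by unfold_locales (auto simp: scale_fun_def fun_eq_iff algebra_simps)

lemma sum_fun_apply: "(\<Sum>a\<in>A. f a) x = (\<Sum>a\<in>A. f a x)" for f :: "'b \<Rightarrow> 'a \<Rightarrow> real"
  by (induction A rule: infinite_finite_induct) auto

text \<open>
  The matrix \<open>f x y\<close> is diagonal with nonzero diagonal, so the \<open>f x\<close> are distinct and independent.
\<close>

lemma card_le_card_span_if_diagonal:
  fixes f :: "'a \<Rightarrow> 'a \<Rightarrow> real"
  assumes "finite B" and span: "\<And>x. x \<in> S \<Longrightarrow> f x \<in> fun_space.span B"
    and diag: "\<And>x. x \<in> S \<Longrightarrow> f x x \<noteq> 0"
    and off: "\<And>x y. x \<in> S \<Longrightarrow> y \<in> S \<Longrightarrow> x \<noteq> y \<Longrightarrow> f x y = 0"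
  shows "finite S \<and> card S \<le> card B"
proof -
  have inj: "inj_on f S"
    by (rule inj_onI) (metis diag off)
  have "\<not> fun_space.dependent (f ` S)"
  proof
    assume "fun_space.dependent (f ` S)"
    then obtain t u g where t: "finite t" "t \<subseteq> f ` S" and g: "g \<in> t" "u g \<noteq> 0"
      and sum0: "(\<Sum>h\<in>t. scale_fun (u h) h) = 0"
      unfolding fun_space.dependent_explicit by blast
    obtain x where x: "x \<in> S" "g = f x" using g t by auto
    have "0 = (\<Sum>h\<in>t. scale_fun (u h) h) x" using sum0 by simp
    also have "\<dots> = (\<Sum>h\<in>t. u h * h x)" by (simp add: sum_fun_apply scale_fun_def)
    also have "\<dots> = (\<Sum>h\<in>t. if h = g then u g * g x else 0)"
      using t x off by (intro sum.cong) auto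
    also have "\<dots> = u g * g x" using t g by simp
    finally show False using g x diag by auto
  qed
  then have "finite (f ` S) \<and> card (f ` S) \<le> card B"
    using span by (intro fun_space.independent_span_bound \<open>finite B\<close>) auto
  then show ?thesis using inj by (simp add: card_image finite_image_iff)
qed

section \<open>Homogeneous polynomial functions\<close>

text \<open>
  Monomials are written as words, without identifying permuted words. This overcounts the
  dimension of the space of homogeneous polynomials, but \<open>n\<^sup>m\<close> is all that is needed.
\<close>

definition monomials :: "nat \<Rightarrow> nat \<Rightarrow> (real Matrix.vec \<Rightarrow> real) set" where
  "monomials n m = (\<lambda>is v. \<Prod>i\<leftarrow>is. v $ i) ` {is. set is \<subseteq> {..<n} \<and> length is = m}"

abbreviation homogeneous :: "nat \<Rightarrow> nat \<Rightarrow> (real Matrix.vec \<Rightarrow> real) set" where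
  "homogeneous n m \<equiv> fun_space.span (monomials n m)"

lemma finite_monomials: "finite (monomials n m)"
  unfolding monomials_def by (intro finite_imageI finite_lists_length_eq) simp

lemma card_monomials_le: "card (monomials n m) \<le> n ^ m"
  unfolding monomials_def
  by (rule order.trans[OF card_image_le])
     (simp_all add: finite_lists_length_eq card_lists_length_eq)

lemma homogeneous_one: "(\<lambda>v. 1) \<in> homogeneous n 0"
  by (rule fun_space.span_base) (auto simp: monomials_def)

lemma homogeneous_coordinate_mult:
  assumes "p \<in> homogeneous n m" and "i < n"
  shows "(\<lambda>v. v $ i * p v) \<in> homogeneous n (Suc m)"
  using assms(1)
proof (induction rule: fun_space.span_induct_alt)
  case base
  have "(\<lambda>v :: real Matrix.vec. v $ i * 0 v) = 0" by auto
  then show ?case by (metis fun_space.span_zero)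
next
  case (step c q r)
  then obtain "is" where "is": "set is \<subseteq> {..<n}" "length is = m" "q = (\<lambda>v. \<Prod>i\<leftarrow>is. v $ i)"
    by (auto simp: monomials_def)
  have "(\<lambda>v. v $ i * q v) \<in> monomials n (Suc m)"
    unfolding monomials_def using "is" \<open>i < n\<close> by (intro image_eqI[of _ _ "i # is"]) auto
  then have "scale_fun c (\<lambda>v. v $ i * q v) + (\<lambda>v. v $ i * r v) \<in> homogeneous n (Suc m)"
    by (intro fun_space.span_add fun_space.span_scale fun_space.span_base step)
  moreover have "scale_fun c (\<lambda>v. v $ i * q v) + (\<lambda>v. v $ i * r v)
      = (\<lambda>v. v $ i * (scale_fun c q + r) v)"
    by (auto simp: scale_fun_def algebra_simps)
  ultimately show ?case by simp
qed

lemma homogeneous_sum: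
  assumes "\<And>i. i \<in> A \<Longrightarrow> p i \<in> homogeneous n m"
  shows "(\<lambda>v. \<Sum>i\<in>A. c i * p i v) \<in> homogeneous n m"
proof -
  have "(\<Sum>i\<in>A. scale_fun (c i) (p i)) \<in> homogeneous n m"
    using assms by (intro fun_space.span_sum fun_space.span_scale)
  moreover have "(\<Sum>i\<in>A. scale_fun (c i) (p i)) = (\<lambda>v. \<Sum>i\<in>A. c i * p i v)"
    by (simp add: fun_eq_iff sum_fun_apply scale_fun_def)
  ultimately show ?thesis by simp
qed

lemma homogeneous_linear_mult:
  assumes "p \<in> homogeneous n m" and "x \<in> carrier_vec n"
  shows "(\<lambda>v. scalar_prod v x * p v) \<in> homogeneous n (Suc m)"
proof -
  have "(\<lambda>v. \<Sum>i<n. (x $ i) * (v $ i * p v)) \<in> homogeneous n (Suc m)"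
    using assms by (intro homogeneous_sum homogeneous_coordinate_mult) auto
  moreover have "(\<lambda>v. scalar_prod v x * p v) = (\<lambda>v. \<Sum>i<n. (x $ i) * (v $ i * p v))"
    using assms by (auto simp: scalar_prod_def sum_distrib_left sum_distrib_right
        lessThan_atLeast0 mult_ac)
  ultimately show ?thesis by simp
qed

text \<open>
  The squared norm is written as a sum over \<open>i < n\<close> so that it is a polynomial on vectors of every
  dimension, not only on those in the carrier.
\<close>

lemma homogeneous_quadratic_mult:
  assumes p: "p \<in> homogeneous n m" and x: "x \<in> carrier_vec n"
  shows "(\<lambda>v. ((scalar_prod v x)\<^sup>2 - c * (\<Sum>i<n. (v $ i)\<^sup>2)) * p v) \<in> homogeneous n (Suc (Suc m))"
proof -
  have "(\<lambda>v. \<Sum>i<n. c * (v $ i * (v $ i * p v))) \<in> homogeneous n (Suc (Suc m))"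
    using p by (intro homogeneous_sum homogeneous_coordinate_mult) auto
  moreover have "(\<lambda>v. scalar_prod v x * (scalar_prod v x * p v)) \<in> homogeneous n (Suc (Suc m))"
    using p x by (intro homogeneous_linear_mult)
  ultimately have "(\<lambda>v. scalar_prod v x * (scalar_prod v x * p v))
      - (\<lambda>v. \<Sum>i<n. c * (v $ i * (v $ i * p v))) \<in> homogeneous n (Suc (Suc m))"
    by (intro fun_space.span_diff)
  moreover have "(\<lambda>v. scalar_prod v x * (scalar_prod v x * p v))
      - (\<lambda>v. \<Sum>i<n. c * (v $ i * (v $ i * p v)))
      = (\<lambda>v. ((scalar_prod v x)\<^sup>2 - c * (\<Sum>i<n. (v $ i)\<^sup>2)) * p v)"
    by (auto simp: fun_eq_iff power2_eq_square algebra_simps sum_distrib_left sum_distrib_right)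
  ultimately show ?thesis by simp
qed

section \<open>The number of points in a shell\<close>

definition shell_poly :: "nat \<Rightarrow> nat \<Rightarrow> real Matrix.vec \<Rightarrow> real Matrix.vec \<Rightarrow> real" where
  "shell_poly n k x v =
    scalar_prod v x * (\<Prod>j=1..<k. (scalar_prod v x)\<^sup>2 - (real j)\<^sup>2 / real k * (\<Sum>i<n. (v $ i)\<^sup>2))"

lemma shell_poly_homogeneous:
  assumes "x \<in> carrier_vec n" and "k \<ge> 1"
  shows "shell_poly n k x \<in> homogeneous n (2 * k - 1)"
proof -
  have "(\<lambda>v. \<Prod>j=1..<Suc l. (scalar_prod v x)\<^sup>2 - (real j)\<^sup>2 / real k * (\<Sum>i<n. (v $ i)\<^sup>2))
      \<in> homogeneous n (2 * l)" for l
  proof (induction l)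
    case 0
    show ?case using homogeneous_one by simp
  next
    case (Suc l)
    show ?case
      using homogeneous_quadratic_mult[OF Suc assms(1), of "(real (Suc l))\<^sup>2 / real k"]
      by (simp add: mult.commute)
  qed
  from homogeneous_linear_mult[OF this[of "k - 1"] assms(1)]
  have "shell_poly n k x \<in> homogeneous n (Suc (2 * (k - 1)))"
    using \<open>k \<ge> 1\<close> by (simp add: shell_poly_def[abs_def])
  moreover have "Suc (2 * (k - 1)) = 2 * k - 1" using \<open>k \<ge> 1\<close> by linarith
  ultimately show ?thesis by (simp only:)
qed

lemma shell_poly_on_shell:
  assumes "v \<in> carrier_vec n" and "scalar_prod v v = real k" and "k \<ge> 1"
  shows "shell_poly n k x v = scalar_prod v x * (\<Prod>j=1..<k. (scalar_prod v x)\<^sup>2 - (real j)\<^sup>2)"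
proof -
  have "(\<Sum>i<n. (v $ i)\<^sup>2) = real k"
    using assms by (simp add: scalar_prod_def power2_eq_square lessThan_atLeast0)
  then show ?thesis using \<open>k \<ge> 1\<close> by (simp add: shell_poly_def)
qed

lemma scalar_prod_self_nonneg: "scalar_prod v v \<ge> (0 :: real)"
  by (simp add: scalar_prod_def sum_nonneg)

lemma scalar_prod_self_eq_0_iff:
  fixes v :: "real Matrix.vec"
  assumes "v \<in> carrier_vec n"
  shows "scalar_prod v v = 0 \<longleftrightarrow> v = 0\<^sub>v n"
  using assms by (auto simp: scalar_prod_def sum_nonneg_eq_0_iff intro!: eq_vecI)

text \<open>
  This is the equality case of the Cauchy-Schwarz inequality, read off from
  \<open>\<parallel>x - y\<parallel>\<^sup>2 > 0\<close> and \<open>\<parallel>x + y\<parallel>\<^sup>2 > 0\<close>.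
\<close>

lemma abs_scalar_prod_less:
  fixes x y :: "real Matrix.vec"
  assumes "x \<in> carrier_vec n" "y \<in> carrier_vec n"
    and "scalar_prod x x = c" "scalar_prod y y = c" and "x \<noteq> y" "x \<noteq> - y"
  shows "\<bar>scalar_prod x y\<bar> < c"
proof -
  have comm: "scalar_prod y x = scalar_prod x y"
    using assms by (simp add: comm_scalar_prod)
  have "x - y \<noteq> 0\<^sub>v n"
  proof
    assume *: "x - y = 0\<^sub>v n"
    have "x = y"
    proof (rule eq_vecI)
      fix i assume "i < dim_vec y"
      then show "x $ i = y $ i"
        using assms arg_cong[OF *, of "\<lambda>v. v $ i"] by auto
    qed (use assms in auto)
    with assms show False by simp
  qed
  then have "scalar_prod (x - y) (x - y) > 0"
    using scalar_prod_self_nonneg[of "x - y"] scalar_prod_self_eq_0_iff[of "x - y" n] assms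
    by auto
  moreover have "x + y \<noteq> 0\<^sub>v n"
  proof
    assume *: "x + y = 0\<^sub>v n"
    have "x = - y"
    proof (rule eq_vecI)
      fix i assume "i < dim_vec (- y)"
      then show "x $ i = (- y) $ i"
        using assms arg_cong[OF *, of "\<lambda>v. v $ i"] by auto
    qed (use assms in auto)
    with assms show False by simp
  qed
  then have "scalar_prod (x + y) (x + y) > 0"
    using scalar_prod_self_nonneg[of "x + y"] scalar_prod_self_eq_0_iff[of "x + y" n] assms
    by auto
  moreover have "scalar_prod (x - y) (x - y) = 2 * c - 2 * scalar_prod x y"
    using assms comm
    by (simp add: minus_scalar_prod_distrib[of _ n] scalar_prod_minus_distrib[of _ n])
  moreover have "scalar_prod (x + y) (x + y) = 2 * c + 2 * scalar_prod x y"
    using assms comm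
    by (simp add: add_scalar_prod_distrib[of _ n] scalar_prod_add_distrib[of _ n])
  ultimately show ?thesis by linarith
qed

text \<open>
  The roots of \<open>t \<Prod>\<^bsub>0<j<k\<^esub> (t\<^sup>2 - j\<^sup>2)\<close> are the integers strictly between \<open>-k\<close> and \<open>k\<close>. These
  are the possible inner products of distinct points here, whereas \<open>\<langle>x,x\<rangle> = k\<close> is not a root.
\<close>

lemma card_antipodal_free_shell_le:
  assumes S: "S \<subseteq> carrier_vec n" and k: "k \<ge> 1"
    and shell: "\<And>x. x \<in> S \<Longrightarrow> scalar_prod x x = real k"
    and int: "\<And>x y. x \<in> S \<Longrightarrow> y \<in> S \<Longrightarrow> scalar_prod x y \<in> \<int>"
    and free: "\<And>x y. x \<in> S \<Longrightarrow> y \<in> S \<Longrightarrow> x \<noteq> - y"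
  shows "finite S \<and> card S \<le> n ^ (2 * k - 1)"
proof -
  have "finite S \<and> card S \<le> card (monomials n (2 * k - 1))"
  proof (rule card_le_card_span_if_diagonal[of _ _ "shell_poly n k"])
    show "finite (monomials n (2 * k - 1))" by (rule finite_monomials)
    show "shell_poly n k x \<in> homogeneous n (2 * k - 1)" if "x \<in> S" for x
      using that S k by (intro shell_poly_homogeneous) auto
    show "shell_poly n k x x \<noteq> 0" if "x \<in> S" for x
      using that S k by (subst shell_poly_on_shell) (auto simp: shell)
    show "shell_poly n k x y = 0" if "x \<in> S" "y \<in> S" "x \<noteq> y" for x y
    proof -
      have "scalar_prod y x \<in> \<int>" using int that by simp
      then obtain z where z: "scalar_prod y x = real_of_int z"
        by (auto elim: Ints_cases)
      have "\<bar>scalar_prod y x\<bar> < real k"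
        using that S by (intro abs_scalar_prod_less[of _ n]) (auto simp: shell free)
      then have small: "nat \<bar>z\<bar> < k" using z by linarith
      have "z = 0 \<or> (\<exists>j\<in>{1..<k}. (scalar_prod y x)\<^sup>2 - (real j)\<^sup>2 = 0)"
      proof (cases "z = 0")
        case False
        then show ?thesis using small z by (intro disjI2 bexI[of _ "nat \<bar>z\<bar>"]) auto
      qed simp
      then show ?thesis
        using that S k z by (subst shell_poly_on_shell) (auto simp: shell prod_zero_iff)
    qed
  qed
  then show ?thesis using card_monomials_le order.trans by blast
qed

lemma card_shell_le:
  assumes X: "X \<subseteq> carrier_vec n" and k: "k \<ge> 1"
    and shell: "\<And>x. x \<in> X \<Longrightarrow> scalar_prod x x = real k"
    and int: "\<And>x y. x \<in> X \<Longrightarrow> y \<in> X \<Longrightarrow> scalar_prod x y \<in> \<int>"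
  shows "finite X \<and> card X \<le> 2 * n ^ (2 * k - 1)"
proof -
  \<comment> \<open>The choice depends only on the set \<open>{x, -x}\<close>, so it picks one point from each antipodal pair.\<close>
  define rep where "rep x = (SOME z. z \<in> {x, - x} \<inter> X)" for x
  define S where "S = rep ` X"
  have rep: "rep x \<in> {x, - x} \<inter> X" if "x \<in> X" for x
    unfolding rep_def by (rule someI[of _ x]) (use that in simp)
  have rep_uminus: "rep (- x) = rep x" for x
    by (simp add: rep_def insert_commute)
  have rep_S: "rep x = x" if "x \<in> S" for x
    using that rep rep_uminus unfolding S_def by (metis Int_iff empty_iff imageE insert_iff)
  have S_X: "S \<subseteq> X" using rep by (fastforce simp: S_def)
  have "finite S \<and> card S \<le> n ^ (2 * k - 1)"
  proof (rule card_antipodal_free_shell_le)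
    show "x \<noteq> - y" if "x \<in> S" "y \<in> S" for x y
    proof
      assume "x = - y"
      then have "x = y" using rep_S rep_uminus that by metis
      have "scalar_prod x x = - scalar_prod x x"
        using \<open>x = - y\<close> \<open>x = y\<close> by (metis scalar_prod_uminus_right)
      then show False using shell[of x] that S_X k by auto
    qed
  qed (use S_X X k shell int in blast)+
  moreover have "X \<subseteq> S \<union> uminus ` S"
  proof
    fix x assume "x \<in> X"
    then have "rep x \<in> S" "rep x = x \<or> rep x = - x" using rep by (auto simp: S_def)
    then show "x \<in> S \<union> uminus ` S" by (metis UnCI image_eqI uminus_uminus_vec)
  qed
  ultimately show ?thesis
    using card_mono[of "S \<union> uminus ` S" X] card_Un_le[of S "uminus ` S"]
      card_image_le[of S uminus] finite_subset[of X "S \<union> uminus ` S"]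
    by auto
qed

section \<open>Summing over the shells\<close>

lemma exp_tau_star:
  assumes "n \<ge> 1" and "scalar_prod y y = real k"
  shows "exp (- tau_star n * (euclid_norm y)\<^sup>2) = 1 / (2 * real n) ^ (2 * k)"
proof -
  have "exp (- tau_star n * (euclid_norm y)\<^sup>2) = exp (- (real (2 * k) * ln (2 * real n)))"
    using assms by (simp add: tau_star_def euclid_norm_def)
  also have "\<dots> = 1 / (2 * real n) ^ (2 * k)"
    using assms by (simp only: exp_minus exp_of_nat_mult) (simp add: inverse_eq_divide)
  finally show ?thesis .
qed

text \<open>
  The factor \<open>2\<close> inside the logarithm of \<open>tau_star\<close> yields \<open>4\<^bsup>-k\<^esup>\<close>, which makes the series over the
  shells converge; the powers of \<open>n\<close> alone cancel against the shell bound, up to one factor \<open>1/n\<close>.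
\<close>

lemma shell_term:
  assumes "n \<ge> 1"
  shows "2 * real n ^ (2 * Suc k - 1) * (1 / (2 * real n) ^ (2 * Suc k)) = (1/4) ^ k / (2 * real n)"
proof -
  have "(2 * real n) ^ (2 * Suc k) = 4 * 4 ^ k * (real n * real n ^ (2 * Suc k - 1))"
    by (simp add: power_mult_distrib power_mult)
  then show ?thesis using assms by (simp add: power_one_over field_simps)
qed

lemma sum_quarter_powers_le: "(\<Sum>k<m. (1/4) ^ k) \<le> (2 :: real)"
  by (subst geometric_sum) (simp_all add: field_simps)

lemma sum_exp_le:
  assumes n: "n \<ge> 1" and F: "finite F" "F \<subseteq> carrier_vec n"
    and int: "\<And>x y. x \<in> F \<Longrightarrow> y \<in> F \<Longrightarrow> scalar_prod x y \<in> \<int>"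
  shows "(\<Sum>y\<in>F. exp (- tau_star n * (euclid_norm y)\<^sup>2)) \<le> 1 + 1 / real n"
proof -
  define q where "q y = nat \<lfloor>scalar_prod y y\<rfloor>" for y :: "real Matrix.vec"
  define N where "N k = card {y \<in> F. q y = k}" for k
  define w where "w k = 1 / (2 * real n) ^ (2 * k)" for k
  have q: "scalar_prod y y = real (q y)" if "y \<in> F" for y
    using int[OF that that] scalar_prod_self_nonneg[of y] by (auto simp: q_def elim!: Ints_cases)
  obtain M where M: "q ` F \<subseteq> {..<Suc M}"
    using finite_nat_iff_bounded_le[of "q ` F"] F(1) by (auto simp: lessThan_Suc_atMost)
  have "{y \<in> F. q y = 0} \<subseteq> {0\<^sub>v n}"
    using q F(2) scalar_prod_self_eq_0_iff[of _ n] by fastforce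
  then have N0: "N 0 \<le> 1"
    unfolding N_def using card_mono[of "{0\<^sub>v n}" "{y \<in> F. q y = 0}"] by simp
  have N_le: "N (Suc k) \<le> 2 * n ^ (2 * Suc k - 1)" for k
    unfolding N_def
  proof (rule conjunct2[OF card_shell_le])
    show "{y \<in> F. q y = Suc k} \<subseteq> carrier_vec n" using F(2) by blast
    show "scalar_prod x x = real (Suc k)" if "x \<in> {y \<in> F. q y = Suc k}" for x
      using that q[of x] by simp
  qed (simp_all add: int)
  have "(\<Sum>y\<in>F. exp (- tau_star n * (euclid_norm y)\<^sup>2)) = (\<Sum>y\<in>F. w (q y))"
    using exp_tau_star[OF n q] by (intro sum.cong) (auto simp: w_def)
  also have "\<dots> = (\<Sum>k<Suc M. \<Sum>y\<in>{y \<in> F. q y = k}. w (q y))"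
    using F(1) M by (subst sum.group) auto
  also have "\<dots> = (\<Sum>k<Suc M. real (N k) * w k)"
    by (intro sum.cong) (simp_all add: N_def)
  also have "\<dots> = real (N 0) * w 0 + (\<Sum>k<M. real (N (Suc k)) * w (Suc k))"
    by (rule sum.lessThan_Suc_shift)
  also have "\<dots> \<le> 1 + (\<Sum>k<M. (1/4) ^ k / (2 * real n))"
  proof (intro add_mono sum_mono)
    show "real (N 0) * w 0 \<le> 1" using N0 by (simp add: w_def)
    fix k
    have "real (N (Suc k)) \<le> 2 * real n ^ (2 * Suc k - 1)"
      using of_nat_mono[OF N_le[of k], where 'a = real] by simp
    then have "real (N (Suc k)) * w (Suc k) \<le> 2 * real n ^ (2 * Suc k - 1) * w (Suc k)"
      by (rule mult_right_mono) (simp add: w_def)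
    then show "real (N (Suc k)) * w (Suc k) \<le> (1/4) ^ k / (2 * real n)"
      using shell_term[OF n, of k] by (simp only: w_def)
  qed
  also have "\<dots> \<le> 1 + 1 / real n"
    using n divide_right_mono[OF sum_quarter_powers_le[of M], of "2 * real n"]
    by (simp only: flip: sum_divide_distrib) simp
  finally show ?thesis .
qed

lemma integral_lattice_subset_carrier:
  assumes "is_integral_lattice n L"
  shows "L \<subseteq> carrier_vec n"
proof -
  interpret vec_module "TYPE(real)" n .
  show ?thesis
    using assms by (fastforce simp: is_integral_lattice_def is_lattice_def lattice_of_def
        intro!: sumlist_carrier dest: nth_mem)
qed

theorem corollary1p2:
  shows "\<exists>C :: real. C > 0 \<and>
    (\<forall>n :: nat. n \<ge> 1 \<longrightarrow>
      (\<forall>L :: real Matrix.vec set. is_integral_lattice n L \<longrightarrow>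
        (\<lambda>y. exp (- tau_star n * (euclid_norm y)\<^sup>2)) summable_on L \<and>
        (\<Sum>\<^sub>\<infinity>y\<in>L. exp (- tau_star n * (euclid_norm y)\<^sup>2)) \<le> 1 + C / real n))"
proof (intro exI[of _ 1] conjI allI impI)
  fix n :: nat and L :: "real Matrix.vec set"
  assume n: "n \<ge> 1" and L: "is_integral_lattice n L"
  let ?f = "\<lambda>y. exp (- tau_star n * (euclid_norm y)\<^sup>2)"
  have bound: "sum ?f F \<le> 1 + 1 / real n" if "finite F" "F \<subseteq> L" for F
    using that L integral_lattice_subset_carrier[OF L]
    by (intro sum_exp_le[OF n]) (auto simp: is_integral_lattice_def)
  show summable_L: "?f summable_on L"
    by (rule nonneg_bdd_above_summable_on) (auto intro!: bdd_aboveI2[where M = "1 + 1 / real n"] bound[simplified])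
  show "infsum ?f L \<le> 1 + 1 / real n"
    by (rule infsum_le_finite_sums[OF summable_L bound])
qed simp

end
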